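(* Let $m,n$ be integers with $1\le m\le n$. Then for every real $x>0$, $$\sum_{k=1}^{n}L(n,k)x^{k}=\frac{e^{-x}}{x^n}\int_0^\infty I_1\bigl(2\sqrt{t}\,\bigr)t^{n-1/2}e^{-t/x}\,\mathrm{d}t,$$ and $$L(n,m)=\frac1{m!}\lim_{x\to0^+}\int_0^\infty I_1\bigl(2\sqrt{t}\,\bigr)t^{n-1/2}\,\frac{\mathrm{d}^m}{\mathrm{d}x^m}\biggl(\frac{e^{-x-t/x}}{x^n}\biggr)\mathrm{d}t.$$
   Context: For integers $1\le k\le n$, the Lah number $L(n,k)$ is the number of ways a set of $n$ elements can be partitioned into $k$ nonempty linearly ordered subsets; explicitly, $L(n,k)=\binom{n-1}{k-1}\frac{n!}{k!}$. $I_\nu$ denotes the modified Bessel function of the first kind, $I_\nu(z)=\sum_{k=0}^\infty\frac{1}{k!\,\Gamma(\nu+k+1)}\left(\frac z2\right)^{2k+\nu}$, where $\Gamma$ is the Euler gamma function; in particular $I_1(2\sqrt t)=\sum_{k=0}^\infty \frac{t^{k+1/2}}{k!\,(k+1)!}$ for $t\ge 0$. *)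

theory Defs
  imports "HOL-Analysis.Analysis" "HOL-Combinatorics.Multiset_Permutations" "HOL-Library.Disjoint_Sets"
begin

text \<open>
  A configuration is a set partition \<open>P\<close> of \<open>{1..n}\<close> into \<open>k\<close> nonempty blocks together with a
  linear order on every block \<open>A \<in> P\<close>, encoded as a duplicate-free list with set of elements \<open>A\<close>.
\<close>

definition lah :: "nat \<Rightarrow> nat \<Rightarrow> nat" where
  "lah n k = card (SIGMA P:{P. partition_on {1..n} P \<and> card P = k}. PiE P permutations_of_set)"

text \<open>
  \<^const>\<open>rGamma\<close> is the entire function \<open>1/\<Gamma>\<close>, so the poles of \<open>\<Gamma>\<close> contribute zero terms.
  On complex numbers, \<open>powr\<close> is the principal branch; on reals the definition is meant for
  \<open>z > 0\<close>, where \<open>powr\<close> is the ordinary power. Because of the convention \<open>0 powr a = 0\<close>, the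
  value at \<open>z = 0\<close> is \<open>0\<close>; this is the correct value for \<open>\<nu> > 0\<close>, but not for \<open>\<nu> = 0\<close>.
\<close>

definition bessel_I :: "'a \<Rightarrow> 'a \<Rightarrow> 'a :: {Gamma, ln}" where
  "bessel_I \<nu> z = (\<Sum>k. rGamma (\<nu> + of_nat k + 1) / fact k * (z / 2) powr (2 * of_nat k + \<nu>))"

end

theory Submission
  imports Defs "HOL-Probability.Distributions" "HOL-Computational_Algebra.Polynomial"
begin

text \<open>
  Write \<open>\<Lambda>\<^sub>n(x) = \<Sum>\<^sub>k L(n,k) x\<^bsup>k\<^esup>\<close>. The Lah numbers are the coefficients that express rising factorials by
  falling ones (\<open>fact_add_eq_sum_lah\<close>). This is Vandermonde's identity once
  \<open>k! L(n,k) = n! (n-1 choose k-1)\<close> is known (\<open>fact_mult_lah\<close>), and the latter follows by counting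
  permutations of \<open>{1..n}\<close> cut into \<open>k\<close> nonempty pieces in two ways. Multiplying the expansion of
  the rising factorial of \<open>N\<close> by \<open>x\<^bsup>N\<^esup>/N!\<close> and summing over \<open>N\<close> gives
  \<open>\<Sum>\<^sub>k (k+n)!/(k! (k+1)!) x\<^bsup>k+1\<^esup> = e\<^bsup>x\<^esup> \<Lambda>\<^sub>n(x)\<close> (\<open>sums_bessel_moment_coeff\<close>).
  
  On the other side, \<open>I\<^sub>1(2\<surd>t) t\<^bsup>n-1/2\<^esup> = \<Sum>\<^sub>k t\<^bsup>k+n\<^esup>/(k! (k+1)!)\<close>. Integrating this termwise against
  \<open>e\<^bsup>-t/x\<^esup>\<close>, each term being a Gamma integral, produces \<open>x\<^bsup>n\<^esup>\<close> times the same series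
  (\<open>has_integral_Ici_bessel_weight\<close>). Comparing the two gives the integral representation.
  
  For the limit, it has to be shown that the \<open>m\<close>-th derivative in \<open>x\<close> commutes with the integral. The
  kernel \<open>e\<^bsup>-x-t/x\<^esup>/x\<^bsup>n\<^esup>\<close> and all its derivatives are linear combinations of the functions
  \<open>t\<^bsup>a\<^esup> e\<^bsup>-x-t/x\<^esup>/x\<^bsup>b\<^esup>\<close>, whose integrals are, up to elementary factors, explicit power series. Differentiating
  these integrals follows the same rule as differentiating the kernels (\<open>bessel_transform_deriv\<close>), so kernel and
  integral remain matched through all derivatives. Hence the integral of the \<open>m\<close>-th derivative is
  the \<open>m\<close>-th derivative of the polynomial \<open>\<Lambda>\<^sub>n\<close>, which tends to \<open>m! L(n,m)\<close> as \<open>x\<close> tends to \<open>0\<close>.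
\<close>

section \<open>Counting partitions into ordered blocks\<close>

lemma card_compositions:
  assumes "1 \<le> k" and "k \<le> n"
  shows "card {ls :: nat list. length ls = k \<and> sum_list ls = n \<and> 0 \<notin> set ls} = (n - 1) choose (k - 1)"
proof -
  have *: "{ls :: nat list. length ls = k \<and> sum_list ls = n \<and> 0 \<notin> set ls} =
     map Suc ` {ls. length ls = k \<and> sum_list ls = n - k}" (is "?L = _ ` ?R")
  proof (intro equalityI subsetI)
    fix ls assume ls: "ls \<in> ?L"
    have "map Suc (map (\<lambda>x. x - 1) ls) = ls"
      using ls by (auto intro!: map_idI) (metis Suc_pred gr0I)
    moreover have "sum_list (map Suc l) = sum_list l + length l" for l by (induction l) auto
    from this[of "map (\<lambda>x. x - 1) ls"]
    have "sum_list (map Suc (map (\<lambda>x. x - 1) ls)) = sum_list (map (\<lambda>x. x - 1) ls) + length ls"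
      by (simp only: length_map)
    ultimately have "sum_list (map (\<lambda>x. x - 1) ls) = n - k"
      using ls by auto
    with \<open>map Suc (map (\<lambda>x. x - 1) ls) = ls\<close> show "ls \<in> map Suc ` ?R"
      using ls by (intro image_eqI[of _ _ "map (\<lambda>x. x - 1) ls"]) auto
  next
    fix ls assume "ls \<in> map Suc ` ?R"
    moreover have "sum_list (map Suc l) = sum_list l + length l" for l by (induction l) auto
    ultimately show "ls \<in> ?L" using assms by auto
  qed
  have "card ?L = card ?R" unfolding * by (intro card_image inj_on_mapI) (auto simp: inj_on_def)
  also have "\<dots> = (n - 1) choose (n - k)"
    using assms by (simp add: card_length_sum_list)
  also have "\<dots> = (n - 1) choose (k - 1)"
    using assms by (subst binomial_symmetric) auto
  finally show ?thesis .
qed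

lemma ex_concat_of_lengths:
  assumes "sum_list ls = length xs"
  shows "\<exists>yss. concat yss = xs \<and> map length yss = ls"
  using assms
proof (induction ls arbitrary: xs)
  case Nil
  then show ?case by (intro exI[of _ "[]"]) auto
next
  case (Cons l ls)
  then have "sum_list ls = length (drop l xs)" by simp
  from Cons.IH[OF this] obtain yss where "concat yss = drop l xs" "map length yss = ls" by auto
  then show ?case using Cons.prems by (intro exI[of _ "take l xs # yss"]) auto
qed

text \<open>
  A permutation of \<open>{1..n}\<close> cut into \<open>k\<close> nonempty consecutive pieces, stored as the list of its
  pieces. This is the object that is counted in two ways: as a permutation with a composition of
  \<open>n\<close>, and as a partition into ordered blocks whose blocks have in addition been put in a row.
\<close>

definition cut_permutations :: "nat \<Rightarrow> nat \<Rightarrow> nat list list set" where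
  "cut_permutations n k =
     {yss. length yss = k \<and> [] \<notin> set yss \<and> concat yss \<in> permutations_of_set {1..n}}"

text \<open>
  Such a list of pieces is determined by its concatenation and by the lengths of its pieces, and
  these two data can be prescribed independently.
\<close>

lemma card_cut_permutations:
  assumes "1 \<le> k" and "k \<le> n"
  shows "card (cut_permutations n k) = fact n * ((n - 1) choose (k - 1))"
proof -
  let ?C = "{ls :: nat list. length ls = k \<and> sum_list ls = n \<and> 0 \<notin> set ls}"
  let ?h = "\<lambda>yss :: nat list list. (concat yss, map length yss)"
  have len: "length xs = n" if "xs \<in> permutations_of_set {1..n}" for xs :: "nat list"
    using that distinct_card[of xs] by (auto simp: permutations_of_set_def)
  have "bij_betw ?h (cut_permutations n k) (permutations_of_set {1..n} \<times> ?C)"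
  proof (intro bij_betw_imageI)
    show "inj_on ?h (cut_permutations n k)"
    proof (rule inj_onI)
      fix yss zss :: "nat list list"
      assume eq: "?h yss = ?h zss"
      then have "length yss = length zss" by (metis length_map snd_conv)
      moreover from this have "length y = length z" if "(y, z) \<in> set (zip yss zss)" for y z
        using that eq by (auto simp: in_set_zip) (metis nth_map)
      ultimately show "yss = zss" using eq by (intro concat_injective) auto
    qed
    show "?h ` cut_permutations n k = permutations_of_set {1..n} \<times> ?C"
    proof (intro equalityI subsetI)
      fix z assume "z \<in> ?h ` cut_permutations n k"
      then show "z \<in> permutations_of_set {1..n} \<times> ?C"
        using len by (force simp: cut_permutations_def length_concat)
    next
      fix z assume z: "z \<in> permutations_of_set {1..n} \<times> ?C"
      obtain xs ls where [simp]: "z = (xs, ls)" by (cases z)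
      from z have "sum_list ls = length xs" using len by simp
      from ex_concat_of_lengths[OF this] obtain yss
        where yss: "concat yss = xs" "map length yss = ls" by blast
      then have "yss \<in> cut_permutations n k"
        using z by (auto simp: cut_permutations_def)
      moreover have "?h yss = z" using yss by simp
      ultimately show "z \<in> ?h ` cut_permutations n k" by (metis (no_types, lifting) image_eqI)
    qed
  qed
  then have "card (cut_permutations n k) = card (permutations_of_set {1..n} \<times> ?C)"
    by (rule bij_betw_same_card)
  then show ?thesis
    using card_compositions[OF assms] by (simp add: card_cartesian_product)
qed

text \<open>
  An arrangement \<open>\<sigma>\<close> of the blocks of a configuration \<open>(P, f)\<close> gives the list of pieces
  \<open>map f \<sigma>\<close>. Mapping \<^const>\<open>set\<close> over this list gives \<open>\<sigma>\<close> back, hence also \<open>P\<close> and \<open>f\<close>; so each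
  configuration arises from exactly \<open>k!\<close> lists of pieces.
\<close>

lemma card_cut_permutations_eq_lah: "card (cut_permutations n k) = fact k * lah n k"
proof -
  let ?S = "SIGMA P:{P. partition_on {1..n} P \<and> card P = k}. PiE P permutations_of_set"
  let ?T = "SIGMA z:?S. permutations_of_set (fst z)"
  let ?h = "\<lambda>(z :: nat set set \<times> (nat set \<Rightarrow> nat list), \<sigma>). map (snd z) \<sigma>"
  have fin: "finite ?S"
  proof (rule finite_SigmaI)
    show "finite {P. partition_on {1..n} P \<and> card P = k}"
      by (rule finite_subset[of _ "Pow (Pow {1..n})"]) (auto simp: partition_on_def)
    fix P assume P: "P \<in> {P. partition_on {1..n} P \<and> card P = k}"
    then have "finite P" using finite_elements by blast
    then show "finite (PiE P permutations_of_set)" by (intro finite_PiE) auto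
  qed
  have setmap: "map set (map f \<sigma>) = \<sigma>"
    if "f \<in> PiE P permutations_of_set" "set \<sigma> = P" for f \<sigma> and P :: "nat set set"
    using that by (auto intro!: map_idI simp: permutations_of_set_def PiE_iff)
  have "bij_betw ?h ?T (cut_permutations n k)"
  proof (intro bij_betw_imageI)
    show "inj_on ?h ?T"
    proof (rule inj_onI, clarsimp)
      fix P P' f f' and \<sigma> \<sigma>' :: "nat set list"
      assume f: "f \<in> PiE P permutations_of_set" "f' \<in> PiE P' permutations_of_set"
        and s: "\<sigma> \<in> permutations_of_set P" "\<sigma>' \<in> permutations_of_set P'"
        and eq: "map f \<sigma> = map f' \<sigma>'"
      have S: "set \<sigma> = P" "set \<sigma>' = P'" using s by (auto simp: permutations_of_set_def)
      have 1: "\<sigma> = \<sigma>'" using setmap[OF f(1) S(1)] setmap[OF f(2) S(2)] eq by simp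
      then have 2: "P = P'" using S by simp
      have "f A = f' A" if "A \<in> P" for A using eq 1 S that by (simp add: map_eq_conv)
      then have "f = f'" using f 2 by (metis PiE_ext)
      with 1 2 show "P = P' \<and> f = f' \<and> \<sigma> = \<sigma>'" by simp
    qed
    show "?h ` ?T = cut_permutations n k"
    proof (intro equalityI subsetI)
      fix yss assume "yss \<in> ?h ` ?T"
      then obtain P f \<sigma> where P: "partition_on {1..n} P" "card P = k"
        and f: "f \<in> PiE P permutations_of_set" and s: "\<sigma> \<in> permutations_of_set P"
        and yss: "yss = map f \<sigma>" by auto
      have S: "set \<sigma> = P" "distinct \<sigma>" using s by (auto simp: permutations_of_set_def)
      have f': "set (f A) = A" "distinct (f A)" if "A \<in> P" for A
        using f that by (auto simp: permutations_of_set_def PiE_iff)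
      have ne: "[] \<notin> set yss" using f' P(1) S yss by (force simp: partition_on_def)
      have len: "length yss = k" using S P(2) yss distinct_card by fastforce
      have "distinct yss" using setmap[OF f S(1)] S(2) yss by (metis distinct_map)
      moreover have "set ys \<inter> set zs = {}" if yz: "ys \<in> set yss" "zs \<in> set yss" "ys \<noteq> zs" for ys zs
      proof -
        obtain A B where "A \<in> P" "B \<in> P" "ys = f A" "zs = f B" using yz yss S(1) by auto
        moreover from this have "A \<noteq> B" using yz by blast
        ultimately show ?thesis using f' P(1) by (simp add: partition_on_def disjoint_def)
      qed
      moreover have "distinct ys" if "ys \<in> set yss" for ys using that f' S(1) yss by auto
      ultimately have "distinct (concat yss)"
        unfolding distinct_concat_iff by (simp add: distinct_removeAll)
      moreover have "set (concat yss) = {1..n}"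
        using f' P(1) S yss by (auto simp: partition_on_def)
      ultimately show "yss \<in> cut_permutations n k"
        using ne len by (simp add: cut_permutations_def permutations_of_set_def)
    next
      fix yss assume yss: "yss \<in> cut_permutations n k"
      define P where "P = set ` set yss"
      define f where "f = restrict (inv_into (set yss) set) P"
      have ne: "[] \<notin> set yss" and len: "length yss = k" and d: "distinct (concat yss)"
        and U: "set (concat yss) = {1..n}"
        using yss by (auto simp: cut_permutations_def permutations_of_set_def)
      (* Only empty pieces could repeat in a duplicate-free concatenation. *)
      have dy: "distinct yss" using d ne by (simp add: distinct_concat_iff)
      have disj: "set ys \<inter> set zs = {}" if "ys \<in> set yss" "zs \<in> set yss" "ys \<noteq> zs" for ys zs
        using d that unfolding distinct_concat_iff by blast
      have inj: "inj_on set (set yss)"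
        by (rule inj_onI) (metis disj inf.idem ne set_empty2)
      have f: "f (set ys) = ys" if "ys \<in> set yss" for ys
        using that inj by (simp add: f_def P_def)
      have "map f (map set yss) = yss" using f by (auto intro!: map_idI)
      moreover have "partition_on {1..n} P"
      proof (rule partition_onI)
        show "\<Union>P = {1..n}" using U by (simp add: P_def)
        show "{} \<notin> P" using ne by (auto simp: P_def)
        show "disjnt p q" if "p \<in> P" "q \<in> P" "p \<noteq> q" for p q
          using that disj by (auto simp: P_def disjnt_def)
      qed
      moreover have "card P = k"
        unfolding P_def using inj dy len by (simp add: card_image distinct_card)
      moreover have "f \<in> PiE P permutations_of_set"
        using f d by (auto simp: PiE_iff P_def permutations_of_set_def distinct_concat_iff)
          (simp add: f_def P_def)
      moreover have "map set yss \<in> permutations_of_set P"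
        using inj dy by (auto simp: permutations_of_set_def P_def distinct_map)
      ultimately show "yss \<in> ?h ` ?T"
        by (intro image_eqI[of _ _ "((P, f), map set yss)"]) auto
    qed
  qed
  then have "card (cut_permutations n k) = card ?T" by (simp add: bij_betw_same_card)
  also have "\<dots> = (\<Sum>z\<in>?S. card (permutations_of_set (fst z)))"
    using fin by (intro card_SigmaI) auto
  also have "\<dots> = (\<Sum>z\<in>?S. fact k)"
  proof (intro sum.cong refl)
    fix z assume "z \<in> ?S"
    then have "finite (fst z)" "card (fst z) = k" using finite_elements[of "{1..n}" "fst z"] by auto
    then show "card (permutations_of_set (fst z)) = fact k" by simp
  qed
  also have "\<dots> = fact k * lah n k" by (simp add: lah_def)
  finally show ?thesis .
qed

corollary fact_mult_lah:
  assumes "1 \<le> k" and "k \<le> n"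
  shows "fact k * lah n k = fact n * ((n - 1) choose (k - 1))"
  using card_cut_permutations[OF assms] card_cut_permutations_eq_lah by metis

section \<open>The exponential generating series of rising factorials\<close>

text \<open>
  With \<open>N = k + 1\<close>, this expands the rising factorial \<open>N(N+1)\<dots>(N+p-1)\<close> in the falling
  factorials \<open>N(N-1)\<dots>(N-j+1)\<close>; the coefficients are the Lah numbers. By the closed form it is
  Vandermonde's identity for \<open>(N + (p - 1)) choose p\<close>.
\<close>

lemma fact_add_eq_sum_lah:
  assumes "1 \<le> p"
  shows "fact (k + p) = fact k * (\<Sum>j = 1..p. fact j * lah p j * (Suc k choose j))"
proof -
  have "(\<Sum>j = 1..p. fact j * lah p j * (Suc k choose j)) =
      fact p * (\<Sum>j = 1..p. (Suc k choose j) * ((p - 1) choose (p - j)))"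
    unfolding sum_distrib_left
  proof (intro sum.cong refl)
    fix j assume j: "j \<in> {1..p}"
    then have "(p - 1) choose (p - j) = (p - 1) choose (j - 1)"
      by (subst binomial_symmetric) auto
    then show "fact j * lah p j * (Suc k choose j) =
        fact p * ((Suc k choose j) * ((p - 1) choose (p - j)))"
      using j fact_mult_lah[of j p] by simp
  qed
  also have "(\<Sum>j = 1..p. (Suc k choose j) * ((p - 1) choose (p - j))) =
      (\<Sum>j\<le>p. (Suc k choose j) * ((p - 1) choose (p - j)))"
    using assms by (intro sum.mono_neutral_left) (auto simp: not_less_eq_eq)
  also have "\<dots> = (k + p) choose p"
    using assms by (simp add: vandermonde)
  finally show ?thesis
    using binomial_fact_lemma[of p "k + p"] by (simp add: algebra_simps)
qed

lemma sums_binomial_exp: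
  fixes x :: real
  shows "(\<lambda>N. fact j * real (N choose j) / fact N * x ^ N) sums (x ^ j * exp x)"
proof -
  have "(\<lambda>i. x ^ j * (x ^ i / fact i)) sums (x ^ j * exp x)"
    using exp_converges[of x] by (intro sums_mult) (simp add: field_simps)
  also have "(\<lambda>i. x ^ j * (x ^ i / fact i)) =
      (\<lambda>i. fact j * real (i + j choose j) / fact (i + j) * x ^ (i + j))"
    by (intro ext) (simp add: binomial_fact power_add field_simps)
  finally have "(\<lambda>N. fact j * real (N choose j) / fact N * x ^ N) sums
      (x ^ j * exp x + (\<Sum>N<j. fact j * real (N choose j) / fact N * x ^ N))"
    by (rule iffD1[OF sums_iff_shift[of "\<lambda>N. fact j * real (N choose j) / fact N * x ^ N" j]])
  moreover have "(\<Sum>N<j. fact j * real (N choose j) / fact N * x ^ N) = 0"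
    by (intro sum.neutral) auto
  ultimately show ?thesis by simp
qed

text \<open>
  Integrating the series of \<open>I\<^sub>1(2\<surd>t) t\<^bsup>p-1/2\<^esup> e\<^bsup>-t/x\<^esup>\<close> termwise yields \<open>x\<^bsup>p+1\<^esup>\<close> times the power series in
  \<open>x\<close> with these coefficients: \<open>(k+p)!\<close> comes from the Gamma integral, the denominator from \<open>I\<^sub>1\<close>.
\<close>

definition bessel_moment_coeff :: "nat \<Rightarrow> nat \<Rightarrow> real" where
  "bessel_moment_coeff p k = fact (k + p) / (fact k * fact (Suc k))"

text \<open>
  A formula of Dobinski type. The \<open>k\<close>-th term is \<open>x\<^bsup>N\<^esup>/N!\<close> times the rising factorial of \<open>N = k + 1\<close>;
  expanded in falling factorials, the \<open>j\<close>-th of these contributes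
  \<open>\<Sum>\<^sub>N N(N-1)\<dots>(N-j+1) x\<^bsup>N\<^esup>/N! = x\<^bsup>j\<^esup> e\<^bsup>x\<^esup>\<close>.
\<close>

lemma sums_bessel_moment_coeff:
  fixes x :: real
  assumes "1 \<le> p"
  shows "(\<lambda>k. bessel_moment_coeff p k * x ^ Suc k) sums
    (exp x * (\<Sum>j = 1..p. real (lah p j) * x ^ j))"
proof -
  let ?g = "\<lambda>N. \<Sum>j = 1..p. real (lah p j) * (fact j * real (N choose j) / fact N * x ^ N)"
  have "?g sums (\<Sum>j = 1..p. real (lah p j) * (x ^ j * exp x))"
    by (intro sums_sum sums_mult sums_binomial_exp)
  (* The sum over j starts at 1, so N = 0 contributes nothing and the index can be shifted. *)
  moreover have "?g 0 = 0" by (intro sum.neutral) auto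
  ultimately have "(\<lambda>k. ?g (Suc k)) sums (\<Sum>j = 1..p. real (lah p j) * (x ^ j * exp x))"
    unfolding sums_Suc_iff[of ?g] by (simp only: add_0_right)
  moreover have "?g (Suc k) = bessel_moment_coeff p k * x ^ Suc k" for k
  proof -
    have "real (fact (k + p)) = real (fact k) * (\<Sum>j = 1..p. fact j * real (lah p j) * real (Suc k choose j))"
      by (subst fact_add_eq_sum_lah[OF assms]) simp
    then have "bessel_moment_coeff p k =
        (\<Sum>j = 1..p. fact j * real (lah p j) * real (Suc k choose j)) / fact (Suc k)"
      unfolding bessel_moment_coeff_def by (simp del: fact_Suc binomial_Suc_Suc)
    then show ?thesis
      by (simp add: sum_distrib_left sum_distrib_right sum_divide_distrib mult_ac del: fact_Suc binomial_Suc_Suc power_Suc)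
  qed
  ultimately show ?thesis
    by (simp add: sum_distrib_left mult_ac del: power_Suc)
qed

section \<open>Moments of the Bessel function\<close>

definition bessel_moment :: "nat \<Rightarrow> real \<Rightarrow> real" where
  "bessel_moment p x = x ^ Suc p * (\<Sum>k. bessel_moment_coeff p k * x ^ k)"

lemma summable_bessel_moment_coeff:
  assumes "1 \<le> p"
  shows "summable (\<lambda>k. bessel_moment_coeff p k * x ^ k)"
proof (cases "x = 0")
  case False
  have "summable (\<lambda>k. (bessel_moment_coeff p k * x ^ Suc k) * inverse x)"
    using sums_bessel_moment_coeff[OF assms, of x] by (intro summable_mult2) (rule sums_summable)
  then show ?thesis using False by (simp add: field_simps)
qed simp

lemma bessel_moment_eq_lah:
  assumes "1 \<le> p"
  shows "bessel_moment p x = exp x * x ^ p * (\<Sum>j = 1..p. real (lah p j) * x ^ j)"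
proof -
  have "(\<lambda>k. bessel_moment_coeff p k * x ^ Suc k) sums
      (x * (\<Sum>k. bessel_moment_coeff p k * x ^ k))"
    using sums_mult[OF summable_sums[OF summable_bessel_moment_coeff[OF assms, of x]], of x]
    by (simp add: mult_ac)
  with sums_bessel_moment_coeff[OF assms, of x]
  have "x * (\<Sum>k. bessel_moment_coeff p k * x ^ k) = exp x * (\<Sum>j = 1..p. real (lah p j) * x ^ j)"
    by (rule sums_unique2[symmetric])
  then show ?thesis by (simp add: bessel_moment_def mult_ac)
qed

text \<open>
  On the level of integrals, this is differentiation under the integral sign:
  \<open>d/dx e\<^bsup>-t/x\<^esup> = t e\<^bsup>-t/x\<^esup> / x\<^sup>2\<close>, and the extra factor \<open>t\<close> raises the index of the moment. On the
  level of power series it only says that the coefficients satisfy \<open>c\<^bsub>p+1\<^esub>(k) = (p + 1 + k) c\<^sub>p(k)\<close>.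
\<close>

lemma has_real_derivative_bessel_moment:
  assumes p: "1 \<le> p" and "x \<noteq> 0"
  shows "(bessel_moment p has_real_derivative bessel_moment (Suc p) x / x ^ 2) (at x)"
proof -
  let ?c = "bessel_moment_coeff p"
  define T where "T = (\<Sum>k. ?c k * x ^ k)"
  define T' where "T' = (\<Sum>k. diffs ?c k * x ^ k)"
  have summ: "summable (\<lambda>k. ?c k * y ^ k)" for y by (rule summable_bessel_moment_coeff[OF p])
  have D: "((\<lambda>x. \<Sum>k. ?c k * x ^ k) has_real_derivative T') (at x)"
    unfolding T'_def by (rule termdiffs_strong_converges_everywhere[OF summ])
  have "summable (\<lambda>k. diffs ?c k * x ^ k)"
    by (rule termdiff_converges_all[OF summ])
  then have "(\<lambda>k. real k * ?c k * x ^ (k - Suc 0)) sums T'"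
    unfolding T'_def by (rule diffs_equiv)
  then have "(\<lambda>k. x * (real k * ?c k * x ^ (k - Suc 0))) sums (x * T')"
    by (rule sums_mult)
  moreover have "(\<lambda>k. real (Suc p) * (?c k * x ^ k)) sums (real (Suc p) * T)"
    unfolding T_def by (intro sums_mult summable_sums summ)
  ultimately have "(\<lambda>k. real (Suc p) * (?c k * x ^ k) + x * (real k * ?c k * x ^ (k - Suc 0))) sums
      (real (Suc p) * T + x * T')"
    by (intro sums_add)
  also have "(\<lambda>k. real (Suc p) * (?c k * x ^ k) + x * (real k * ?c k * x ^ (k - Suc 0))) =
      (\<lambda>k. bessel_moment_coeff (Suc p) k * x ^ k)"
  proof
    fix k
    have "x * (real k * ?c k * x ^ (k - Suc 0)) = real k * ?c k * x ^ k"
      by (cases k) auto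
    moreover have "bessel_moment_coeff (Suc p) k = (real (Suc p) + real k) * ?c k"
      by (simp add: bessel_moment_coeff_def add_ac)
    ultimately show "real (Suc p) * (?c k * x ^ k) + x * (real k * ?c k * x ^ (k - Suc 0)) =
        bessel_moment_coeff (Suc p) k * x ^ k"
      by (simp only: algebra_simps)
  qed
  finally have rec: "bessel_moment (Suc p) x = x ^ Suc (Suc p) * (real (Suc p) * T + x * T')"
    unfolding bessel_moment_def by (simp add: sums_iff)
  have "((\<lambda>x. x ^ Suc p * (\<Sum>k. ?c k * x ^ k)) has_real_derivative
      real (Suc p) * x ^ p * T + x ^ Suc p * T') (at x)"
    using DERIV_mult[OF DERIV_pow[of "Suc p" x] D] by (simp add: T_def mult_ac)
  moreover have "real (Suc p) * x ^ p * T + x ^ Suc p * T' = bessel_moment (Suc p) x / x ^ 2"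
    unfolding rec using assms(2) by (simp add: power2_eq_square field_simps)
  ultimately show ?thesis unfolding bessel_moment_def[abs_def] by simp
qed

text \<open>
  Integrability and the value of the integral together, so that both pass through sums and scalar
  multiples in one step.
\<close>

abbreviation has_integral_Ici :: "(real \<Rightarrow> real) \<Rightarrow> real \<Rightarrow> bool" where
  "has_integral_Ici f v \<equiv> has_bochner_integral lborel (\<lambda>t. indicator {0..} t *\<^sub>R f t) v"

lemma has_integral_Ici_power_exp:
  assumes "0 < x"
  shows "has_integral_Ici (\<lambda>t. t ^ q * exp (- t / x)) (fact q * x ^ Suc q)"
proof -
  have "has_integral_Ici (\<lambda>t. t ^ q * exp (- t)) (fact q)"
  proof (rule has_bochner_integral_nn_integral)
    have "(\<integral>\<^sup>+t. ennreal (indicator {0..} t *\<^sub>R (t ^ q * exp (- t))) \<partial>lborel) =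
        (\<integral>\<^sup>+t. ennreal (t ^ q * exp (- t)) * indicator {0..} t \<partial>lborel)"
      by (intro nn_integral_cong) (auto split: split_indicator)
    then show "(\<integral>\<^sup>+t. ennreal (indicator {0..} t *\<^sub>R (t ^ q * exp (- t))) \<partial>lborel) = ennreal (fact q)"
      by (simp add: nn_intergal_power_times_exp_Ici)
  qed (auto split: split_indicator)
  then have "has_bochner_integral lborel
      (\<lambda>t. indicator {0..} (0 + 1 / x * t) *\<^sub>R ((0 + 1 / x * t) ^ q * exp (- (0 + 1 / x * t))))
      (fact q /\<^sub>R \<bar>1 / x\<bar>)"
    using assms by (subst (asm) lborel_has_bochner_integral_real_affine_iff[of "1 / x" _ _ 0]) auto
  from has_bochner_integral_mult_right[OF this, of "x ^ q"]
  have "has_bochner_integral lborel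
      (\<lambda>t. x ^ q * (indicator {0..} (0 + 1 / x * t) *\<^sub>R ((0 + 1 / x * t) ^ q * exp (- (0 + 1 / x * t)))))
      (x ^ q * (fact q /\<^sub>R \<bar>1 / x\<bar>))" by simp
  also have "(\<lambda>t. x ^ q * (indicator {0..} (0 + 1 / x * t) *\<^sub>R ((0 + 1 / x * t) ^ q * exp (- (0 + 1 / x * t)))))
      = (\<lambda>t. indicator {0..} t *\<^sub>R (t ^ q * exp (- t / x)))"
    using assms by (auto simp: fun_eq_iff power_divide zero_le_divide_iff split: split_indicator)
  also have "x ^ q * (fact q /\<^sub>R \<bar>1 / x\<bar>) = fact q * x ^ Suc q"
    using assms by simp
  finally show ?thesis .
qed

definition bessel_weight :: "nat \<Rightarrow> real \<Rightarrow> real" where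
  "bessel_weight n t = bessel_I 1 (2 * sqrt t) * t powr (real n - 1 / 2)"

text \<open>
  The half-integer exponents of the Bessel series and of the power of \<open>t\<close> add up to natural
  numbers. At \<open>t = 0\<close> both sides vanish, because \<open>n\<close> is positive and \<open>0 powr a = 0\<close>.
\<close>

lemma sums_bessel_weight:
  assumes "1 \<le> n" and "0 \<le> t"
  shows "(\<lambda>k. t ^ (k + n) / (fact k * fact (Suc k))) sums bessel_weight n t"
proof (cases "t = 0")
  case True
  with assms have "(\<lambda>k. t ^ (k + n) / (fact k * fact (Suc k))) = (\<lambda>k. 0)"
    by (intro ext) (simp add: power_0_left)
  with True show ?thesis by (simp add: bessel_weight_def del: fact_Suc)
next
  case False
  with assms have t: "0 < t" by simp
  let ?b = "\<lambda>k. rGamma (1 + real k + 1) / fact k * (2 * sqrt t / 2) powr (2 * real k + 1)"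
  have b: "?b k * t powr (real n - 1 / 2) = t ^ (k + n) / (fact k * fact (Suc k))" for k
  proof -
    have "rGamma (1 + real k + 1) = 1 / fact (Suc k)"
      using Gamma_fact[of "Suc k", where 'a = real]
      by (simp add: rGamma_inverse_Gamma add_ac inverse_eq_divide)
    moreover have "(2 * sqrt t / 2) powr (2 * real k + 1) * t powr (real n - 1 / 2) = t ^ (k + n)"
    proof -
      have "(2 * sqrt t / 2) powr (2 * real k + 1) = t powr (real k + 1 / 2)"
        using t by (simp add: powr_half_sqrt[symmetric] powr_powr algebra_simps)
      then have "(2 * sqrt t / 2) powr (2 * real k + 1) * t powr (real n - 1 / 2) =
          t powr real (k + n)"
        by (simp flip: powr_add)
      then show ?thesis using t by (simp only: powr_realpow)
    qed
    ultimately show ?thesis by (simp add: field_simps del: fact_Suc)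
  qed
  have "summable (\<lambda>k. t ^ (k + n) / (fact k * fact (Suc k)))"
  proof (rule summable_comparison_test')
    show "summable (\<lambda>k. t ^ n * (t ^ k / fact k))"
      using summable_exp[of t] by (intro summable_mult) (simp add: field_simps)
    show "norm (t ^ (k + n) / (fact k * fact (Suc k))) \<le> t ^ n * (t ^ k / fact k)" for k
    proof -
      have "t ^ (k + n) / (fact k * fact (Suc k)) = t ^ n * (t ^ k / fact k) / fact (Suc k)"
        by (simp add: power_add)
      also have "\<dots> \<le> t ^ n * (t ^ k / fact k) / 1"
        using t fact_ge_1[of "Suc k"] by (intro divide_left_mono) auto
      finally show ?thesis using t by simp
    qed
  qed
  then have *: "summable (\<lambda>k. ?b k * t powr (real n - 1 / 2))" by (simp only: b)
  from summable_mult2[OF this, of "t powr - (real n - 1 / 2)"]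
  have "summable ?b" using t by (simp add: mult.assoc flip: powr_add)
  then have "(\<lambda>k. ?b k * t powr (real n - 1 / 2)) sums ((\<Sum>k. ?b k) * t powr (real n - 1 / 2))"
    by (intro sums_mult2 summable_sums)
  then show ?thesis by (simp only: b bessel_weight_def bessel_I_def)
qed

text \<open>
  All terms of the series of the weight are nonnegative on the half line, so summability of the
  Gamma integrals of the terms justifies integrating termwise.
\<close>

lemma has_integral_Ici_bessel_weight:
  assumes n: "1 \<le> n" and x: "0 < x"
  shows "has_integral_Ici (\<lambda>t. bessel_weight n t * (t ^ a * exp (- t / x))) (bessel_moment (n + a) x)"
proof -
  define f where "f k t = indicator {0..} t *\<^sub>R
    (t ^ (k + n + a) * exp (- t / x)) * (1 / (fact k * fact (Suc k)))" for k and t :: real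
  let ?g = "\<lambda>t. indicator {0..} t *\<^sub>R (bessel_weight n t * (t ^ a * exp (- t / x)))"
  have hbi: "has_bochner_integral lborel (f k) (bessel_moment_coeff (n + a) k * x ^ k * x ^ Suc (n + a))" for k
  proof -
    have "has_bochner_integral lborel (f k) ((fact (k + n + a) * x ^ Suc (k + n + a)) * (1 / (fact k * fact (Suc k))))"
      unfolding f_def
      by (intro has_bochner_integral_mult_left has_integral_Ici_power_exp[OF x])
    then show ?thesis
      by (simp add: bessel_moment_coeff_def power_add field_simps del: fact_Suc)
  qed
  have norm_f: "norm (f k t) = f k t" for k t
    by (auto simp: f_def split: split_indicator)
  have sums_f: "(\<lambda>k. f k t) sums ?g t" for t
  proof (cases "0 \<le> t")
    case True
    from sums_mult2[OF sums_bessel_weight[OF n this], of "t ^ a * exp (- t / x)"] True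
    show ?thesis by (simp add: f_def power_add mult_ac)
  qed (simp add: f_def)
  have summ: "summable (\<lambda>k. bessel_moment_coeff (n + a) k * x ^ k)"
    using n by (intro summable_bessel_moment_coeff) simp
  have int: "integrable lborel (f k)"
    and val: "integral\<^sup>L lborel (f k) = bessel_moment_coeff (n + a) k * x ^ k * x ^ Suc (n + a)" for k
    using hbi[of k] by (auto simp: has_bochner_integral_iff)
  have A: "AE t in lborel. summable (\<lambda>k. norm (f k t))"
    unfolding norm_f using sums_f by (auto simp: sums_iff)
  have B: "summable (\<lambda>k. \<integral>t. norm (f k t) \<partial>lborel)"
    unfolding norm_f val by (intro summable_mult2 summ)
  have g: "(\<lambda>t. \<Sum>k. f k t) = ?g" using sums_f by (auto simp: sums_iff)
  have "integral\<^sup>L lborel ?g = (\<Sum>k. bessel_moment_coeff (n + a) k * x ^ k * x ^ Suc (n + a))"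
    using integral_suminf[OF int A B] unfolding g val .
  also have "\<dots> = bessel_moment (n + a) x"
    unfolding bessel_moment_def using suminf_mult2[OF summ, of "x ^ Suc (n + a)"] by (simp add: mult_ac)
  finally show ?thesis
    using integrable_suminf[OF int A B] unfolding g by (simp add: has_bochner_integral_iff)
qed

section \<open>Differentiating under the integral sign\<close>

text \<open>
  Pairs of a kernel and its integral against the weight, as functions of the parameter \<open>y\<close>. The
  kernels are the linear combinations of \<open>t\<^bsup>a\<^esup> e\<^bsup>-y-t/y\<^esup> / y\<^bsup>b\<^esup>\<close>: a class that contains the kernel of the
  theorem, is closed under differentiation in \<open>y\<close>, and has explicit integrals.
\<close>

inductive bessel_transform :: "nat \<Rightarrow> (real \<Rightarrow> real \<Rightarrow> real) \<Rightarrow> (real \<Rightarrow> real) \<Rightarrow> bool" for n where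
  base: "bessel_transform n (\<lambda>t y. t ^ a * (exp (- y - t / y) / y ^ b))
           (\<lambda>y. exp (- y) / y ^ b * bessel_moment (n + a) y)"
| add: "bessel_transform n f F \<Longrightarrow> bessel_transform n g G \<Longrightarrow>
    bessel_transform n (\<lambda>t y. f t y + g t y) (\<lambda>y. F y + G y)"
| scale: "bessel_transform n f F \<Longrightarrow> bessel_transform n (\<lambda>t y. c * f t y) (\<lambda>y. c * F y)"

lemma bessel_transform_has_integral:
  assumes "bessel_transform n f F" and n: "1 \<le> n" and y: "0 < y"
  shows "has_integral_Ici (\<lambda>t. bessel_weight n t * f t y) (F y)"
  using assms(1)
proof induction
  case (base a b)
  from has_bochner_integral_mult_right[OF has_integral_Ici_bessel_weight[OF n y, of a], of "exp (- y) / y ^ b"]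
  have "has_bochner_integral lborel
     (\<lambda>t. exp (- y) / y ^ b * (indicator {0..} t *\<^sub>R (bessel_weight n t * (t ^ a * exp (- t / y)))))
     (exp (- y) / y ^ b * bessel_moment (n + a) y)" by simp
  also have "(\<lambda>t. exp (- y) / y ^ b * (indicator {0..} t *\<^sub>R (bessel_weight n t * (t ^ a * exp (- t / y))))) =
    (\<lambda>t. indicator {0..} t *\<^sub>R (bessel_weight n t * (t ^ a * (exp (- y - t / y) / y ^ b))))"
    by (simp add: fun_eq_iff exp_diff exp_minus field_simps)
  finally show ?case .
next
  case (add f F g G)
  from has_bochner_integral_add[OF add.IH] show ?case by (simp add: algebra_simps)
next
  case (scale f F c)
  from has_bochner_integral_mult_right[OF scale.IH, of c] show ?case by (simp add: algebra_simps)
qed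

lemma has_real_derivative_divide_power:
  fixes h :: "real \<Rightarrow> real"
  assumes "(h has_real_derivative D) (at y)" and "y \<noteq> 0"
  shows "((\<lambda>y. h y / y ^ b) has_real_derivative D / y ^ b - real b * (h y / y ^ Suc b)) (at y)"
proof (cases b)
  case (Suc c)
  from DERIV_divide[OF assms(1) DERIV_pow[of b y]] assms(2) Suc show ?thesis
    by (rule_tac DERIV_cong) (auto simp: field_simps)
qed (use assms in simp)

text \<open>
  Both components of a generating pair obey the same differentiation rule
  \<open>(a, b)' = - (a, b) + (a + 1, b + 2) - b (a, b + 1)\<close>. For the kernel the middle term comes from
  \<open>e\<^bsup>-t/y\<^esup>\<close>, for the integral from the derivative of the moment.
\<close>

lemma bessel_transform_deriv:
  assumes "bessel_transform n f F" and n: "1 \<le> n"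
  shows "\<exists>f' F'. bessel_transform n f' F' \<and>
    (\<forall>y>0. (\<forall>t. (f t has_real_derivative f' t y) (at y)) \<and> (F has_real_derivative F' y) (at y))"
  using assms(1)
proof induction
  case (base a b)
  let ?e = "\<lambda>a b t y. t ^ a * (exp (- y - t / y) / y ^ b) :: real"
  let ?E = "\<lambda>a b y. exp (- y) / y ^ b * bessel_moment (n + a) y"
  let ?f = "\<lambda>t y. (- 1 * ?e a b t y + ?e (Suc a) (b + 2) t y) + - real b * ?e a (Suc b) t y"
  let ?F = "\<lambda>y. (- 1 * ?E a b y + ?E (Suc a) (b + 2) y) + - real b * ?E a (Suc b) y"
  have "bessel_transform n ?f ?F"
    by (intro bessel_transform.intros)
  moreover have "(?e a b t has_real_derivative ?f t y) (at y)" if "0 < y" for t y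
  proof -
    have "((\<lambda>y. exp (- y - t / y)) has_real_derivative exp (- y - t / y) * (- 1 + t / y ^ 2)) (at y)"
      using that by (auto intro!: derivative_eq_intros simp: power2_eq_square)
    from DERIV_cmult[OF has_real_derivative_divide_power[OF this, of b], of "t ^ a"] that
    show ?thesis
      by (rule_tac DERIV_cong) (auto simp: field_simps power2_eq_square)
  qed
  moreover have "(?E a b has_real_derivative ?F y) (at y)" if "0 < y" for y
  proof -
    have "((\<lambda>y. exp (- y)) has_real_derivative - exp (- y)) (at y)"
      by (auto intro!: derivative_eq_intros)
    from DERIV_mult[OF has_real_derivative_divide_power[OF this, of b]
          has_real_derivative_bessel_moment[of "n + a" y]] that n
    show ?thesis
      by (rule_tac DERIV_cong) (auto simp: field_simps power2_eq_square)
  qed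
  ultimately show ?case by blast
next
  case (add f F g G)
  then obtain f' F' g' G' where
    "bessel_transform n f' F'" "bessel_transform n g' G'"
    "\<And>y. 0 < y \<Longrightarrow> (\<forall>t. (f t has_real_derivative f' t y) (at y)) \<and> (F has_real_derivative F' y) (at y)"
    "\<And>y. 0 < y \<Longrightarrow> (\<forall>t. (g t has_real_derivative g' t y) (at y)) \<and> (G has_real_derivative G' y) (at y)"
    by blast
  then show ?case
    by (intro exI[of _ "\<lambda>t y. f' t y + g' t y"] exI[of _ "\<lambda>y. F' y + G' y"])
       (auto intro!: bessel_transform.add DERIV_add)
next
  case (scale f F c)
  then obtain f' F' where "bessel_transform n f' F'"
    "\<And>y. 0 < y \<Longrightarrow> (\<forall>t. (f t has_real_derivative f' t y) (at y)) \<and> (F has_real_derivative F' y) (at y)"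
    by blast
  then show ?case
    by (intro exI[of _ "\<lambda>t y. c * f' t y"] exI[of _ "\<lambda>y. c * F' y"])
       (auto intro!: bessel_transform.scale DERIV_cmult)
qed

lemma deriv_eq_on_pos:
  fixes f g g' :: "real \<Rightarrow> real"
  assumes "\<And>y. 0 < y \<Longrightarrow> f y = g y" and "(g has_real_derivative D) (at y)" and "0 < y"
  shows "deriv f y = D"
proof -
  have "eventually (\<lambda>z. f z = g z) (nhds y)"
    using eventually_nhds_in_open[of "{0<..}" y] assms(1,3) by (auto elim: eventually_mono)
  then show ?thesis
    using deriv_cong_ev[of f g y y] DERIV_imp_deriv[OF assms(2)] by simp
qed

text \<open>
  Since \<^const>\<open>deriv\<close> only sees a neighbourhood of the point, formulas on the open half line
  suffice; at \<open>y = 0\<close> the kernels are in general singular.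
\<close>

lemma bessel_transform_higher_deriv:
  assumes "bessel_transform n f F" and n: "1 \<le> n"
  shows "\<exists>f' F'. bessel_transform n f' F' \<and>
    (\<forall>y>0. (\<forall>t. (deriv ^^ m) (f t) y = f' t y) \<and> (deriv ^^ m) F y = F' y)"
proof (induction m)
  case 0
  show ?case using assms(1) by (intro exI[of _ f] exI[of _ F]) simp
next
  case (Suc m)
  then obtain g G where "bessel_transform n g G"
    and g: "\<And>y t. 0 < y \<Longrightarrow> (deriv ^^ m) (f t) y = g t y" "\<And>y. 0 < y \<Longrightarrow> (deriv ^^ m) F y = G y"
    by blast
  from bessel_transform_deriv[OF this(1) n] obtain g' G' where "bessel_transform n g' G'"
    and D: "\<And>y t. 0 < y \<Longrightarrow> (g t has_real_derivative g' t y) (at y)"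
      "\<And>y. 0 < y \<Longrightarrow> (G has_real_derivative G' y) (at y)"
    by blast
  moreover have "(deriv ^^ Suc m) (f t) y = g' t y" if "0 < y" for t y
    using deriv_eq_on_pos[OF g(1) D(1)] that by simp
  moreover have "(deriv ^^ Suc m) F y = G' y" if "0 < y" for y
    using deriv_eq_on_pos[OF g(2) D(2)] that by simp
  ultimately show ?case by blast
qed

section \<open>The integral representation and the limit\<close>

lemma higher_deriv_poly: "(deriv ^^ m) (poly p) = poly ((pderiv ^^ m) p)" for p :: "real poly"
  by (induction m) (auto intro!: ext DERIV_imp_deriv)

lemma bessel_transform_kernel:
  "bessel_transform n (\<lambda>t y. exp (- y - t / y) / y ^ n) (\<lambda>y. exp (- y) / y ^ n * bessel_moment n y)"
  using bessel_transform.base[of n 0 n] by simp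

theorem theorem2p1:
  fixes m n :: nat
  assumes "1 \<le> m" and "m \<le> n"
  shows
    "(\<forall>x::real. x > 0 \<longrightarrow>
        set_integrable lborel {0..}
          (\<lambda>t. bessel_I 1 (2 * sqrt t) * t powr (real n - 1 / 2) * exp (- t / x)) \<and>
        (\<Sum>k = 1..n. real (lah n k) * x ^ k) =
          exp (- x) / x ^ n *
            (LBINT t:{0..}. bessel_I 1 (2 * sqrt t) * t powr (real n - 1 / 2) * exp (- t / x)))
     \<and>
     (\<forall>x::real. x > 0 \<longrightarrow>
        set_integrable lborel {0..}
          (\<lambda>t. bessel_I 1 (2 * sqrt t) * t powr (real n - 1 / 2) *
                 (deriv ^^ m) (\<lambda>y. exp (- y - t / y) / y ^ n) x))
     \<and>
     (\<exists>l::real.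
        ((\<lambda>x::real. LBINT t:{0..}. bessel_I 1 (2 * sqrt t) * t powr (real n - 1 / 2) *
                 (deriv ^^ m) (\<lambda>y. exp (- y - t / y) / y ^ n) x) \<longlongrightarrow> l) (at_right 0) \<and>
        real (lah n m) = 1 / fact m * l)"
proof -
  from assms have n: "1 \<le> n" by simp
  let ?W = "\<lambda>t. bessel_I 1 (2 * sqrt t) * t powr (real n - 1 / 2)"
  let ?K = "\<lambda>t y. exp (- y - t / y) / y ^ n :: real"
  define L where "L = (\<Sum>k = 1..n. monom (real (lah n k)) k)"
  have L: "poly L y = (\<Sum>k = 1..n. real (lah n k) * y ^ k)" for y
    by (simp add: L_def poly_sum poly_monom)
  have moment: "exp (- y) / y ^ n * bessel_moment n y = poly L y" if "0 < y" for y
    using that bessel_moment_eq_lah[OF n, of y] by (simp add: L exp_minus)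
  have int1: "has_integral_Ici (\<lambda>t. ?W t * exp (- t / x)) (bessel_moment n x)" if "0 < x" for x
    using has_integral_Ici_bessel_weight[OF n that, of 0] by (simp add: bessel_weight_def)
  obtain f F where fF: "bessel_transform n f F"
    and f: "\<And>y t. 0 < y \<Longrightarrow> (deriv ^^ m) (?K t) y = f t y"
    and F: "\<And>y. 0 < y \<Longrightarrow> (deriv ^^ m) (\<lambda>y. exp (- y) / y ^ n * bessel_moment n y) y = F y"
    using bessel_transform_higher_deriv[OF bessel_transform_kernel n, of m] by blast
  have F_poly: "F y = poly ((pderiv ^^ m) L) y" if "0 < y" for y
  proof -
    have "eventually (\<lambda>z. exp (- z) / z ^ n * bessel_moment n z = poly L z) (nhds y)"
      using eventually_nhds_in_open[of "{0<..}" y] that moment by (auto elim: eventually_mono)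
    from higher_deriv_cong_ev[OF this refl, of m] F[OF that] show ?thesis
      by (simp add: higher_deriv_poly)
  qed
  have int2: "has_integral_Ici (\<lambda>t. ?W t * (deriv ^^ m) (?K t) x) (F x)" if "0 < x" for x
    using bessel_transform_has_integral[OF fF n that] f[OF that] by (simp add: bessel_weight_def)
  (* For x > 0 this integral is the m-th derivative of the polynomial L, so its limit at 0 is
     the value there, which is m! times the m-th coefficient. *)
  have "((\<lambda>x. poly ((pderiv ^^ m) L) x) \<longlongrightarrow> poly ((pderiv ^^ m) L) 0) (at_right 0)"
    by (intro tendsto_intros)
  moreover have "eventually (\<lambda>x. poly ((pderiv ^^ m) L) x =
      (LBINT t:{0..}. ?W t * (deriv ^^ m) (?K t) x)) (at_right 0)"
    unfolding eventually_at_right_field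
    using int2 by (intro exI[of _ 1]) (auto simp: set_lebesgue_integral_def has_bochner_integral_iff F_poly)
  ultimately have lim: "((\<lambda>x. LBINT t:{0..}. ?W t * (deriv ^^ m) (?K t) x) \<longlongrightarrow>
      poly ((pderiv ^^ m) L) 0) (at_right 0)"
    by (rule Lim_transform_eventually)
  have "poly ((pderiv ^^ m) L) 0 = fact m * coeff L m"
    by (simp add: poly_0_coeff_0 coeff_higher_pderiv pochhammer_fact)
  also have "coeff L m = real (lah n m)"
    using assms by (simp add: L_def coeff_sum sum.delta)
  finally have "real (lah n m) = 1 / fact m * poly ((pderiv ^^ m) L) 0" by simp
  moreover have "set_integrable lborel {0..} (\<lambda>t. ?W t * exp (- t / x)) \<and>
      (\<Sum>k = 1..n. real (lah n k) * x ^ k) =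
        exp (- x) / x ^ n * (LBINT t:{0..}. ?W t * exp (- t / x))" if "0 < x" for x
    using int1[OF that] moment[OF that]
    by (simp add: set_integrable_def set_lebesgue_integral_def has_bochner_integral_iff L)
  moreover have "set_integrable lborel {0..} (\<lambda>t. ?W t * (deriv ^^ m) (?K t) x)" if "0 < x" for x
    using int2[OF that] by (simp add: set_integrable_def has_bochner_integral_iff)
  ultimately show ?thesis using lim by blast
qed

end
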